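(* Let $N\ge 1$, let $\phi\in C^1((0,+\infty);(0,+\infty))$ satisfy $(\phi(s)s)'>0$ and $l-1\le \frac{(\phi(s)s)'}{\phi(s)}\le m-1$ for all $s>0$, where $1<l\le m$ are real constants, and let $V\in C^1(\mathbb R^N;\mathbb R)$. Let $c\in\mathbb R$ be such that $\mathcal V_c=\{x\in\mathbb R^N: V(x)\le c\}$ is the union of two nonempty sets $\mathcal V_c^-,\mathcal V_c^+$ with $\operatorname{dist}(\mathcal V_c^-,\mathcal V_c^+)>0$, and suppose that there exists $R>0$ such that $\inf_{\Gamma_c}J_c=\inf\{J_c(q): q\in\Gamma_c,\ \|q\|_{L^\infty(\mathbb R;\mathbb R^N)}\le R\}$. Let $q$ be a $c$-connection between $\mathcal V_c^-$ and $\mathcal V_c^+$ with contact times $\alpha$ and $\omega$. (a) If $\alpha\in\mathbb R$ and $\omega=+\infty$, let $q_c(t)=q(2\alpha-t)$ for $t<\alpha$ and $q_c(t)=q(t)$ for $t\ge\alpha$. Then $q_c\in C^1(\mathbb R;\mathbb R^N)\cap C^2(\mathbb R\setminus\{\alpha\};\mathbb R^N)$ is an entire weak solution of $(\phi(|\dot q|)\dot q)'=\nabla V(q)$, classical on $(-\infty,\alpha)$ and $(\alpha,+\infty)$. Moreover $q_c$ has constant energy $E_{q_c}\equiv-c$ and satisfies $\dot q_c(\alpha)=0$, $q_c(\alpha)\in\mathcal V_c^-$, $V(q_c(t))>c$ if $t\ne\alpha$, $q_c(\alpha-t)=q_c(\alpha+t)$ for all $t\in\mathbb R$, together with $\lim_{t\to\pm\infty}\dot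 q_c(t)=0$ and $\lim_{t\to\pm\infty}\operatorname{dist}(q_c(t),\mathcal V_c^+)=0$. (b) If $\alpha=-\infty$ and $\omega\in\mathbb R$, let $q_c(t)=q(t)$ for $t\le\omega$ and $q_c(t)=q(2\omega-t)$ for $t>\omega$. Then $q_c\in C^1(\mathbb R;\mathbb R^N)\cap C^2(\mathbb R\setminus\{\omega\};\mathbb R^N)$ is an entire weak solution of $(\phi(|\dot q|)\dot q)'=\nabla V(q)$, classical on $(-\infty,\omega)$ and $(\omega,+\infty)$. Moreover $q_c$ has constant energy $E_{q_c}\equiv-c$ and satisfies $\dot q_c(\omega)=0$, $q_c(\omega)\in\mathcal V_c^+$, $V(q_c(t))>c$ if $t\ne\omega$, $q_c(\omega-t)=q_c(\omega+t)$ for all $t\in\mathbb R$, together with $\lim_{t\to\pm\infty}\dot q_c(t)=0$ and $\lim_{t\to\pm\infty}\operatorname{dist}(q_c(t),\mathcal V_c^-)=0$.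
   Context: Set $\Phi(s)=\int_0^{|s|}\phi(r)r\,dr$ and $G(s)=\phi(s)s^2-\Phi(s)$ for $s>0$, $G(0)=0$; $\phi(|v|)v$ is read as $0$ when $v=0$. $\operatorname{dist}$ is Euclidean distance. The energy is $E_q(t)=G(|\dot q(t)|)-V(q(t))$. For an interval $I$, $L^\Phi(I;\mathbb R^N)$ is the set of $q\in L^1_{loc}(I;\mathbb R^N)$ with $\int_I\Phi(|q|/\lambda)\,dt<\infty$ for some $\lambda>0$; $W^{1,\Phi}(I;\mathbb R^N)$ is the set of $q\in L^\Phi$ with weak derivative in $L^\Phi$; $W^{1,\Phi}_{loc}(\mathbb R;\mathbb R^N)$ consists of functions whose restriction to every compact interval $I$ lies in $W^{1,\Phi}(I;\mathbb R^N)$ (identified with continuous representatives). $J_c(q)=\int_{\mathbb R}(\Phi(|\dot q|)+V(q)-c)\,dt$; $\Gamma_c$ is the set of $q\in W^{1,\Phi}_{loc}(\mathbb R;\mathbb R^N)$ with $V(q(t))\ge c$ for all $t$ and $\liminf_{t\to-\infty}\operatorname{dist}(q(t),\mathcal V_c^-)=\liminf_{t\to+\infty}\operatorname{dist}(q(t),\mathcal V_c^+)=0$. Let $I=(\alpha,\omega)$, $-\infty\le\alpha<\omega\le+\infty$, with closure $\bar I$ in $\mathbb R$. A function $q:\bar I\to\mathbb R^N$ is a $c$-connection between $\mathcal V_c^-$ and $\mathcal V_c^+$ with contact times $\alpha,\omega$ if $q\in L^\infty(I;\mathbb R^N)$ and: (i) $q\in C^1(\bar I;\mathbb R^N)\cap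 C^2(I;\mathbb R^N)$ and $(\phi(|\dot q|)\dot q)'=\nabla V(q)$ on $I$; (ii) $V(q(t))>c$ and $E_q(t)=-c$ for all $t\in I$; (iii) $\lim_{t\to\alpha^+}\operatorname{dist}(q(t),\mathcal V_c^-)=\lim_{t\to\omega^-}\operatorname{dist}(q(t),\mathcal V_c^+)=0$. A weak solution on an open interval $A$ is a function $q$ with $\int_A\big(\phi(|\dot q|)\dot q\cdot\dot\psi+\nabla V(q)\cdot\psi\big)\,dt=0$ for all $\psi\in C_0^\infty(A;\mathbb R^N)$; entire means $A=\mathbb R$. *)

theory Defs
  imports "HOL-Analysis.Analysis" "HOL-Probability.Essential_Supremum"
begin

text \<open>On sets that are not open, derivatives are taken within the set; at an endpoint of a closed
  interval they are one-sided.\<close>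

fun Ck_on :: "nat \<Rightarrow> real set \<Rightarrow> (real \<Rightarrow> 'a::real_normed_vector) \<Rightarrow> bool" where
  "Ck_on 0 S f \<longleftrightarrow> continuous_on S f"
| "Ck_on (Suc k) S f \<longleftrightarrow>
     (\<forall>t\<in>S. f differentiable (at t within S)) \<and>
     Ck_on k S (\<lambda>t. vector_derivative f (at t within S))"

definition test_function :: "real set \<Rightarrow> (real \<Rightarrow> 'a::real_normed_vector) \<Rightarrow> bool" where
  "test_function A \<psi> \<longleftrightarrow> (\<forall>k. Ck_on k UNIV \<psi>) \<and>
     compact (closure {t. \<psi> t \<noteq> 0}) \<and> closure {t. \<psi> t \<noteq> 0} \<subseteq> A"

definition grad :: "('a::real_inner \<Rightarrow> real) \<Rightarrow> 'a \<Rightarrow> 'a" where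
  "grad V x = (THE D. GDERIV V x :> D)"

definition \<Phi> :: "(real \<Rightarrow> real) \<Rightarrow> real \<Rightarrow> real" where
  "\<Phi> \<phi> s = integral {0..\<bar>s\<bar>} (\<lambda>r. \<phi> r * r)"

definition G :: "(real \<Rightarrow> real) \<Rightarrow> real \<Rightarrow> real" where
  "G \<phi> s = (if s = 0 then 0 else \<phi> s * s\<^sup>2 - \<Phi> \<phi> s)"

definition energy ::
  "(real \<Rightarrow> real) \<Rightarrow> ('a::real_normed_vector \<Rightarrow> real) \<Rightarrow> (real \<Rightarrow> 'a) \<Rightarrow> real \<Rightarrow> real" where
  "energy \<phi> V q t = G \<phi> (norm (vector_derivative q (at t))) - V (q t)"


subsection \<open>Function spaces\<close>

definition Linf_norm :: "real set \<Rightarrow> (real \<Rightarrow> 'a::euclidean_space) \<Rightarrow> ennreal" where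
  "Linf_norm I q = esssup (lebesgue_on I) (\<lambda>t. ennreal (norm (q t)))"

definition Linf :: "real set \<Rightarrow> (real \<Rightarrow> 'a::euclidean_space) set" where
  "Linf I = {q. q \<in> borel_measurable (lebesgue_on I) \<and> Linf_norm I q < \<infinity>}"

definition L1_loc :: "real set \<Rightarrow> (real \<Rightarrow> 'a::euclidean_space) set" where
  "L1_loc I = {q. q \<in> borel_measurable (lebesgue_on I) \<and>
     (\<forall>K. compact K \<and> K \<subseteq> I \<longrightarrow> set_integrable lebesgue K q)}"

definition Orlicz :: "(real \<Rightarrow> real) \<Rightarrow> real set \<Rightarrow> (real \<Rightarrow> 'a::euclidean_space) set" where
  "Orlicz \<phi> I = {q \<in> L1_loc I. \<exists>k>0.
     (\<integral>\<^sup>+t\<in>I. ennreal (\<Phi> \<phi> (norm (q t) / k)) \<partial>lebesgue) < \<infinity>}"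

definition has_weak_derivative ::
  "real set \<Rightarrow> (real \<Rightarrow> 'a::euclidean_space) \<Rightarrow> (real \<Rightarrow> 'a) \<Rightarrow> bool" where
  "has_weak_derivative I q g \<longleftrightarrow> q \<in> L1_loc I \<and> g \<in> L1_loc I \<and>
     (\<forall>\<psi> :: real \<Rightarrow> real. test_function (interior I) \<psi> \<longrightarrow>
        (LINT t:I|lebesgue. vector_derivative \<psi> (at t) *\<^sub>R q t) =
        - (LINT t:I|lebesgue. \<psi> t *\<^sub>R g t))"

definition W1_Orlicz :: "(real \<Rightarrow> real) \<Rightarrow> real set \<Rightarrow> (real \<Rightarrow> 'a::euclidean_space) set" where
  "W1_Orlicz \<phi> I = {q \<in> Orlicz \<phi> I. \<exists>g \<in> Orlicz \<phi> I. has_weak_derivative I q g}"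

text \<open>The continuity requirement selects the continuous representative of each class.\<close>

definition W1_Orlicz_loc :: "(real \<Rightarrow> real) \<Rightarrow> (real \<Rightarrow> 'a::euclidean_space) set" where
  "W1_Orlicz_loc \<phi> = {q. continuous_on UNIV q \<and> (\<forall>a b. a < b \<longrightarrow> q \<in> W1_Orlicz \<phi> {a..b})}"


subsection \<open>The variational problem\<close>

definition \<Gamma> :: "(real \<Rightarrow> real) \<Rightarrow> ('a::euclidean_space \<Rightarrow> real) \<Rightarrow> real \<Rightarrow> 'a set \<Rightarrow> 'a set \<Rightarrow>
    (real \<Rightarrow> 'a) set" where
  "\<Gamma> \<phi> V c Vm Vp = {q \<in> W1_Orlicz_loc \<phi>. (\<forall>t. V (q t) \<ge> c) \<and>
     Liminf at_bot (\<lambda>t. ereal (infdist (q t) Vm)) = 0 \<and>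
     Liminf at_top (\<lambda>t. ereal (infdist (q t) Vp)) = 0}"

text \<open>The functional takes values in \<open>[0, \<infinity>]\<close>. It is only used on \<open>\<Gamma> \<phi> V c Vm Vp\<close>, where the
  integrand is nonnegative, so nothing is lost by \<open>ennreal\<close>. The weak derivative is unique up to
  null sets, hence the choice does not affect the integral.\<close>

definition J :: "(real \<Rightarrow> real) \<Rightarrow> ('a::euclidean_space \<Rightarrow> real) \<Rightarrow> real \<Rightarrow> (real \<Rightarrow> 'a) \<Rightarrow> ennreal" where
  "J \<phi> V c q = (let q' = (SOME g. has_weak_derivative UNIV q g) in
     \<integral>\<^sup>+t. ennreal (\<Phi> \<phi> (norm (q' t)) + V (q t) - c) \<partial>lebesgue)"


subsection \<open>Solutions and connections\<close>

text \<open>The term \<open>\<phi> (norm v) *\<^sub>R v\<close> is \<open>0\<close> at \<open>v = 0\<close>, whatever the value of \<open>\<phi>\<close> at \<open>0\<close>.\<close>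

definition classical_solution ::
  "(real \<Rightarrow> real) \<Rightarrow> ('a::euclidean_space \<Rightarrow> real) \<Rightarrow> real set \<Rightarrow> (real \<Rightarrow> 'a) \<Rightarrow> bool" where
  "classical_solution \<phi> V A q \<longleftrightarrow> Ck_on 2 A q \<and>
     (\<forall>t\<in>A. ((\<lambda>s. \<phi> (norm (vector_derivative q (at s))) *\<^sub>R vector_derivative q (at s))
        has_vector_derivative grad V (q t)) (at t))"

text \<open>Integrability is required explicitly because the Bochner integral of a non-integrable
  function is \<open>0\<close> by convention.\<close>

definition weak_solution ::
  "(real \<Rightarrow> real) \<Rightarrow> ('a::euclidean_space \<Rightarrow> real) \<Rightarrow> real set \<Rightarrow> (real \<Rightarrow> 'a) \<Rightarrow> bool" where
  "weak_solution \<phi> V A q \<longleftrightarrow> (\<exists>q'. has_weak_derivative A q q' \<and>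
     (\<forall>\<psi> :: real \<Rightarrow> 'a. test_function A \<psi> \<longrightarrow>
        (let f = (\<lambda>t. (\<phi> (norm (q' t)) *\<^sub>R q' t) \<bullet> vector_derivative \<psi> (at t)
                      + grad V (q t) \<bullet> \<psi> t)
         in set_integrable lebesgue A f \<and> (LINT t:A|lebesgue. f t) = 0)))"

text \<open>The path \<open>q\<close> is a function on \<open>closure I\<close>, represented by a total function whose values
  elsewhere are irrelevant. Since the contact times may be infinite, the limits are taken in the
  extended reals; at \<open>\<alpha> = -\<infinity>\<close> and \<open>\<omega> = \<infinity>\<close> the filters are those of \<open>t \<rightarrow> \<mp>\<infinity>\<close>.\<close>

definition c_connection ::
  "(real \<Rightarrow> real) \<Rightarrow> ('a::euclidean_space \<Rightarrow> real) \<Rightarrow> real \<Rightarrow> 'a set \<Rightarrow> 'a set \<Rightarrow> ereal \<Rightarrow> ereal \<Rightarrow>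
    (real \<Rightarrow> 'a) \<Rightarrow> bool" where
  "c_connection \<phi> V c Vm Vp \<alpha> \<omega> q \<longleftrightarrow> \<alpha> < \<omega> \<and>
     (let I = einterval \<alpha> \<omega> in
       q \<in> Linf I \<and>
       Ck_on 1 (closure I) q \<and> classical_solution \<phi> V I q \<and>
       (\<forall>t\<in>I. V (q t) > c \<and> energy \<phi> V q t = - c) \<and>
       ((\<lambda>t. infdist (q (real_of_ereal t)) Vm) \<longlongrightarrow> 0) (at_right \<alpha>) \<and>
       ((\<lambda>t. infdist (q (real_of_ereal t)) Vp) \<longlongrightarrow> 0) (at_left \<omega>))"

end

theory Submission
  imports Defs
begin

text \<open>
  Since \<open>V (q t) > c\<close> along the connection and the contact point lies in the closed set \<open>{x. V x \<le> c}\<close>,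
  continuity forces \<open>V = c\<close> there, so by energy conservation \<open>G \<phi> (norm (q' t))\<close> vanishes at the
  contact time and hence so does the velocity. The equation is time reversible, so the orbit may be
  continued by reflection: with zero velocity at the contact time the doubled path is \<open>C\<^sup>1\<close>, and the flux
  \<open>\<phi> (norm q') *\<^sub>R q'\<close> is continuous across it, which makes the path a weak solution. At the infinite
  end \<open>V (q t)\<close> tends to \<open>c\<close> because \<open>q\<close> is bounded, and energy conservation again sends the
  velocity to \<open>0\<close>. Part (b) is part (a) for the time-reversed connection.
\<close>

subsection \<open>Differentiable functions and test functions\<close>

text \<open>Derivatives within \<open>S\<close> at points of \<open>S\<close> see only the values on
  \<open>S\<close>, so agreement passes to the derivatives; the induction therefore has to leave
  both functions arbitrary.\<close>

lemma Ck_on_cong: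
  assumes "\<And>t. t \<in> S \<Longrightarrow> f t = g t" and "Ck_on k S g"
  shows "Ck_on k S f"
  using assms
proof (induction k arbitrary: f g)
  case 0
  then show ?case
    by (simp cong: continuous_on_cong)
next
  case (Suc k)
  have eq: "(f has_vector_derivative d) (at t within S) \<longleftrightarrow> (g has_vector_derivative d) (at t within S)"
    if "t \<in> S" for t d
    using Suc.prems(1) that by (intro has_vector_derivative_cong_ev) (auto simp: eventually_inf_principal)
  then have "vector_derivative f (at t within S) = vector_derivative g (at t within S)" if "t \<in> S" for t
    using that by (simp add: vector_derivative_def)
  moreover have "f differentiable at t within S" if "t \<in> S" for t
    using Suc.prems(2) eq that vector_derivative_works differentiableI_vector by (metis Ck_on.simps(2))
  ultimately show ?case
    using Suc.IH[of "\<lambda>t. vector_derivative f (at t within S)" "\<lambda>t. vector_derivative g (at t within S)"] Suc.prems(2)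
    by simp
qed

text \<open>On an open set the derivative within the set is the ordinary one. Regularity can thus be
  read off an explicit formula for \<open>f'\<close> instead of
  \<open>vector_derivative\<close>.\<close>

lemma Ck_on_SucI_open:
  assumes "open S" and "\<And>t. t \<in> S \<Longrightarrow> (f has_vector_derivative f' t) (at t)" and "Ck_on k S f'"
  shows "Ck_on (Suc k) S f"
proof -
  have "(f has_vector_derivative f' t) (at t within S)" if "t \<in> S" for t
    using assms(2)[OF that] by (rule has_vector_derivative_at_within)
  moreover have "vector_derivative f (at t within S) = f' t" if "t \<in> S" for t
    using vector_derivative_at[OF assms(2)[OF that]] at_within_open[OF that assms(1)] by simp
  ultimately show ?thesis
    using assms(3) by (auto intro: differentiableI_vector Ck_on_cong)
qed

text \<open>Extracts the data that integration by parts consumes, with a single bound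
  \<open>M\<close> beyond which both the test function and its derivative vanish.\<close>

lemma test_function_UNIV:
  fixes \<psi> :: "real \<Rightarrow> 'a::real_normed_vector"
  assumes "test_function UNIV \<psi>"
  shows "(\<psi> has_vector_derivative vector_derivative \<psi> (at t)) (at t)"
    and "continuous_on UNIV \<psi>"
    and "continuous_on UNIV (\<lambda>t. vector_derivative \<psi> (at t))"
    and "\<exists>M. \<forall>t. \<bar>t\<bar> \<ge> M \<longrightarrow> \<psi> t = 0 \<and> vector_derivative \<psi> (at t) = 0"
proof -
  define K where "K = closure {t. \<psi> t \<noteq> 0}"
  have "Ck_on (Suc 0) UNIV \<psi>" and K: "compact K"
    using assms unfolding test_function_def K_def by blast+
  then have d: "(\<psi> has_vector_derivative vector_derivative \<psi> (at t)) (at t)"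
    and c: "continuous_on UNIV (\<lambda>t. vector_derivative \<psi> (at t))" for t
    by (auto simp: vector_derivative_works)
  obtain B where B: "\<And>t. t \<in> K \<Longrightarrow> norm t \<le> B"
    using compact_imp_bounded[OF K] unfolding bounded_iff by blast
  have out: "\<psi> t = 0" if "t \<notin> K" for t
    using that closure_subset[of "{t. \<psi> t \<noteq> 0}"] unfolding K_def by blast
  \<comment> \<open>Off the closed set \<open>K\<close> the function vanishes on a whole
    neighbourhood, so its derivative vanishes too.\<close>
  have d0: "vector_derivative \<psi> (at t) = 0" if "t \<notin> K" for t
  proof -
    have "((\<lambda>_. 0) has_vector_derivative vector_derivative \<psi> (at t)) (at t)"
      using that out compact_imp_closed[OF K]
      by (intro has_vector_derivative_transform_within_open[OF d, of "- K"]) auto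
    then show ?thesis
      using has_vector_derivative_const vector_derivative_unique_at by blast
  qed
  \<comment> \<open>The radius is \<open>B + 1\<close> because points with absolute value exactly
    \<open>B\<close> may still lie in \<open>K\<close>.\<close>
  have "t \<notin> K" if "\<bar>t\<bar> \<ge> B + 1" for t
    using B[of t] that by auto
  then show "\<exists>M. \<forall>t. \<bar>t\<bar> \<ge> M \<longrightarrow> \<psi> t = 0 \<and> vector_derivative \<psi> (at t) = 0"
    using out d0 by blast
  show "(\<psi> has_vector_derivative vector_derivative \<psi> (at t)) (at t)"
    and "continuous_on UNIV (\<lambda>t. vector_derivative \<psi> (at t))"
    by (rule d c)+
  show "continuous_on UNIV \<psi>"
    using d by (meson continuous_at_imp_continuous_on has_vector_derivative_continuous)
qed

section \<open>Integrals of compactly supported functions, and local and essential bounds\<close>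

lemma integrable_continuous_compact_support:
  fixes f :: "real \<Rightarrow> 'a::euclidean_space"
  assumes "continuous_on UNIV f" and f0: "\<And>t. \<bar>t\<bar> \<ge> M \<Longrightarrow> f t = 0"
  shows "integrable lebesgue f" and "integral\<^sup>L lebesgue f = integral {-\<bar>M\<bar>..\<bar>M\<bar>} f"
proof -
  \<comment> \<open>The absolute value keeps the interval nonempty when \<open>M\<close> is
    negative; outside it \<open>f\<close> still vanishes.\<close>
  let ?S = "{-\<bar>M\<bar>..\<bar>M\<bar>}"
  have f: "f = (\<lambda>t. indicator ?S t *\<^sub>R f t)"
    using f0 by (force simp: indicator_def)
  have si: "set_integrable lebesgue ?S f"
    using assms(1) by (intro absolutely_integrable_continuous_real) (auto intro: continuous_on_subset)
  show "integrable lebesgue f"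
    using si unfolding set_integrable_def by (subst f)
  have "integral\<^sup>L lebesgue f = (LINT t:?S|lebesgue. f t)"
    unfolding set_lebesgue_integral_def by (subst f) (rule refl)
  then show "integral\<^sup>L lebesgue f = integral ?S f"
    using has_integral_set_lebesgue[OF si] by (simp add: integral_unique)
qed

text \<open>The fundamental theorem of calculus with vanishing boundary terms. Exceptional points in
  \<open>S\<close> are harmless because \<open>F\<close> is continuous across them; this admits the
  kink of the flux at the contact time.\<close>

lemma integral_derivative_compact_support:
  fixes F f :: "real \<Rightarrow> 'a::euclidean_space"
  assumes "continuous_on UNIV F" and "continuous_on UNIV f" and "finite S"
    and "\<And>t. t \<notin> S \<Longrightarrow> (F has_vector_derivative f t) (at t)"
    and F0: "\<And>t. \<bar>t\<bar> \<ge> M \<Longrightarrow> F t = 0" and f0: "\<And>t. \<bar>t\<bar> \<ge> M \<Longrightarrow> f t = 0"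
  shows "integral\<^sup>L lebesgue f = 0"
proof -
  have "(f has_integral (F \<bar>M\<bar> - F (-\<bar>M\<bar>))) {-\<bar>M\<bar>..\<bar>M\<bar>}"
    using assms(1,3,4)
    by (intro fundamental_theorem_of_calculus_strong[where S = S]) (auto intro: continuous_on_subset)
  then show ?thesis
    using F0 integrable_continuous_compact_support(2)[OF assms(2) f0] by (simp add: integral_unique)
qed

lemma continuous_L1_loc:
  fixes f :: "real \<Rightarrow> 'a::euclidean_space"
  assumes "continuous_on UNIV f"
  shows "f \<in> L1_loc UNIV"
  unfolding L1_loc_def
proof (intro CollectI conjI allI impI)
  show "f \<in> borel_measurable (lebesgue_on UNIV)"
    using assms by (intro continuous_imp_measurable_on_sets_lebesgue) auto
  fix K :: "real set" assume K: "compact K \<and> K \<subseteq> UNIV"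
  then have "bounded K"
    by (simp add: compact_imp_bounded)
  then obtain B where "\<And>t. t \<in> K \<Longrightarrow> norm t \<le> B"
    unfolding bounded_iff by blast
  then have "K \<subseteq> {-B..B}" by force
  moreover have "set_integrable lebesgue {-B..B} f"
    using assms by (intro absolutely_integrable_continuous_real) (auto intro: continuous_on_subset)
  ultimately show "set_integrable lebesgue K f"
    using K compact_imp_closed[of K] by (auto intro: set_integrable_subset[rotated 2])
qed

text \<open>The set where the essential bound is exceeded is open by continuity and null, hence
  empty.\<close>

lemma continuous_Linf_bounded:
  fixes q :: "real \<Rightarrow> 'a::euclidean_space"
  assumes "open I" and "continuous_on I q" and "q \<in> Linf I"
  shows "bounded (q ` I)"
proof -
  have "Linf_norm I q < \<infinity>"
    using assms(3) by (simp add: Linf_def)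
  then obtain K where K: "Linf_norm I q = ennreal K" "K \<ge> 0"
    by (cases "Linf_norm I q" rule: ennreal_cases) auto
  have "AE t in lebesgue_on I. ennreal (norm (q t)) \<le> ennreal K"
    using esssup_AE[where M = "lebesgue_on I" and f = "\<lambda>t. ennreal (norm (q t))"] K(1)
    unfolding Linf_norm_def by simp
  then have "AE t in lebesgue_on I. norm (q t) \<le> K"
    using K by simp
  then have ae: "AE t \<in> I in lebesgue. t \<in> - {t \<in> I. norm (q t) > K}"
    using \<open>open I\<close> by (subst (asm) AE_restrict_space_iff) (auto elim: eventually_mono)
  have "open (I \<inter> (\<lambda>t. norm (q t)) -` {K<..})"
    using assms by (intro continuous_open_preimage continuous_intros) auto
  then have "closed (- {t \<in> I. norm (q t) > K})"
    by (auto simp: vimage_def Int_def)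
  then have "norm (q t) \<le> K" if "t \<in> I" for t
    using mem_closed_if_AE_lebesgue_open[OF \<open>open I\<close> _ ae that] that by auto
  then show ?thesis
    unfolding bounded_iff by blast
qed

subsection \<open>The differential operator\<close>

text \<open>The lower growth bound is kept multiplied out, without the quotient by
  \<open>\<phi> s\<close>. Together with \<open>l > 1\<close> it makes the flux
  \<open>\<phi> s * s\<close> tend to \<open>0\<close> at \<open>0\<close>.\<close>

locale phi_operator =
  fixes \<phi> :: "real \<Rightarrow> real" and l :: real
  assumes phi_pos: "s > 0 \<Longrightarrow> \<phi> s > 0"
    and l_gt_1: "l > 1"
    and phi_differentiable: "s > 0 \<Longrightarrow> \<phi> differentiable (at s)"
    and flux_deriv_pos: "s > 0 \<Longrightarrow> deriv (\<lambda>r. \<phi> r * r) s > 0"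
    and flux_deriv_ge: "s > 0 \<Longrightarrow> (l - 1) * \<phi> s \<le> deriv (\<lambda>r. \<phi> r * r) s"
begin

lemma flux_DERIV:
  assumes "s > 0"
  shows "((\<lambda>r. \<phi> r * r) has_real_derivative deriv (\<lambda>r. \<phi> r * r) s) (at s)"
  unfolding DERIV_deriv_iff_real_differentiable
  by (rule differentiable_mult[OF phi_differentiable[OF assms] differentiable_ident])

lemma flux_less:
  assumes "0 < s" "s < u"
  shows "\<phi> s * s < \<phi> u * u"
proof (rule DERIV_pos_imp_increasing[OF \<open>s < u\<close>])
  fix x assume "s \<le> x"
  then have "x > 0" using assms by simp
  then show "\<exists>y. ((\<lambda>r. \<phi> r * r) has_real_derivative y) (at x) \<and> 0 < y"
    using flux_DERIV flux_deriv_pos by blast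
qed

text \<open>The lower bound on the logarithmic derivative makes \<open>\<phi> s * s / s powr (l - 1)\<close> nondecreasing.\<close>

lemma flux_le_powr:
  assumes "0 < s" "s \<le> 1"
  shows "\<phi> s * s \<le> \<phi> 1 * s powr (l - 1)"
proof -
  define D where "D = deriv (\<lambda>r. \<phi> r * r)"
  have "\<phi> s * s * s powr (1 - l) \<le> \<phi> 1 * 1 * 1 powr (1 - l)"
  proof (rule DERIV_nonneg_imp_nondecreasing[OF \<open>s \<le> 1\<close>])
    fix x assume "s \<le> x" "x \<le> 1"
    then have x: "x > 0" using assms by simp
    have "((\<lambda>r. \<phi> r * r * r powr (1 - l)) has_real_derivative
        (\<phi> x * x) * ((1 - l) * x powr (1 - l - 1)) + D x * x powr (1 - l)) (at x)"
      unfolding D_def by (rule DERIV_mult'[OF flux_DERIV[OF x] has_real_derivative_powr[OF x]])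
    moreover have "(\<phi> x * x) * ((1 - l) * x powr (1 - l - 1)) + D x * x powr (1 - l) \<ge> 0"
    proof -
      have "(\<phi> x * x) * ((1 - l) * x powr (1 - l - 1)) = (1 - l) * \<phi> x * (x * x powr (1 - l - 1))"
        by (simp only: mult_ac)
      also have "x * x powr (1 - l - 1) = x powr (1 - l)"
        using x by (simp add: powr_mult_base)
      finally have "(\<phi> x * x) * ((1 - l) * x powr (1 - l - 1)) + D x * x powr (1 - l)
          = (D x - (l - 1) * \<phi> x) * x powr (1 - l)"
        by (simp only: left_diff_distrib)
      then show ?thesis
        using flux_deriv_ge[OF x] by (simp add: D_def)
    qed
    ultimately show "\<exists>y. ((\<lambda>r. \<phi> r * r * r powr (1 - l)) has_real_derivative y) (at x) \<and> 0 \<le> y"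
      by blast
  qed
  then have "\<phi> s * s * s powr (1 - l) * s powr (l - 1) \<le> \<phi> 1 * s powr (l - 1)"
    by (intro mult_right_mono) auto
  moreover have "s powr (1 - l) * s powr (l - 1) = 1"
    using assms by (simp flip: powr_add)
  ultimately show ?thesis
    by (simp only: mult.assoc mult_1_right)
qed

text \<open>The flux is squeezed between \<open>0\<close> and a multiple of
  \<open>s powr (l - 1)\<close>, whose exponent is positive.\<close>

lemma flux_tendsto_0: "((\<lambda>s. \<phi> s * s) \<longlongrightarrow> 0) (at_right 0)"
proof (rule tendsto_sandwich[where f = "\<lambda>_. 0"])
  show "\<forall>\<^sub>F s in at_right 0. 0 \<le> \<phi> s * s"
    using phi_pos by (auto simp: eventually_at_right_field less_imp_le intro!: exI[of _ 1])
  show "\<forall>\<^sub>F s in at_right 0. \<phi> s * s \<le> \<phi> 1 * s powr (l - 1)"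
    using flux_le_powr by (auto simp: eventually_at_right_field intro!: exI[of _ 1])
  have "((\<lambda>s. s powr (l - 1)) \<longlongrightarrow> 0 powr (l - 1)) (at_right 0)"
    using l_gt_1 by (intro tendsto_powr' tendsto_intros) (auto simp: eventually_at_filter)
  then show "((\<lambda>s. \<phi> 1 * s powr (l - 1)) \<longlongrightarrow> 0) (at_right 0)"
    using tendsto_mult_right_zero by (simp add: tendsto_mult_right_zero)
qed simp

text \<open>At \<open>0\<close> the product is \<open>0\<close> whatever the value
  \<open>\<phi> 0\<close>, so the limit from the right equals the value there.\<close>

lemma flux_continuous: "continuous_on {0..} (\<lambda>s. \<phi> s * s)"
  unfolding continuous_on_eq_continuous_within
proof
  fix s :: real assume "s \<in> {0..}"
  then consider "s = 0" | "s > 0" by force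
  then show "continuous (at s within {0..}) (\<lambda>s. \<phi> s * s)"
  proof cases
    case 1
    have "at 0 within {0..} = at_right (0::real)"
    proof -
      have "{0::real..} - {0} = {0<..} - {0}" by auto
      then show ?thesis by (simp add: at_within_def)
    qed
    then show ?thesis
      using flux_tendsto_0 1 by (simp add: continuous_within)
  next
    case 2
    then show ?thesis
      using DERIV_isCont[OF flux_DERIV] continuous_at_imp_continuous_within by blast
  qed
qed

text \<open>The critical point is \<open>v = 0\<close>, where the norm of the vector flux is the
  scalar flux at \<open>norm v\<close>. This gives continuity of the flux of the doubled path
  through its instant of rest.\<close>

lemma flux_vector_continuous:
  "continuous_on UNIV (\<lambda>v::'a::real_normed_vector. \<phi> (norm v) *\<^sub>R v)"
  unfolding continuous_on_eq_continuous_within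
proof
  fix v :: 'a
  show "isCont (\<lambda>v. \<phi> (norm v) *\<^sub>R v) v"
  proof (cases "v = 0")
    case True
    have "filterlim norm (at_right 0) (at (0::'a))"
      by (auto simp: filterlim_at eventually_at_filter tendsto_norm_zero)
    then have "((\<lambda>v::'a. \<phi> (norm v) * norm v) \<longlongrightarrow> 0) (at 0)"
      by (rule filterlim_compose[OF flux_tendsto_0])
    moreover have "norm (\<phi> (norm v) *\<^sub>R v) = \<phi> (norm v) * norm v" for v :: 'a
      using phi_pos[of "norm v"] by (cases "v = 0") simp_all
    ultimately have "((\<lambda>v::'a. norm (\<phi> (norm v) *\<^sub>R v)) \<longlongrightarrow> 0) (at 0)"
      by (simp only:)
    then have "((\<lambda>v::'a. \<phi> (norm v) *\<^sub>R v) \<longlongrightarrow> 0) (at 0)"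
      by (rule tendsto_norm_zero_cancel)
    then show ?thesis
      using True by (simp add: isCont_def)
  next
    case False
    then have "isCont \<phi> (norm v)"
      using phi_differentiable by (simp add: differentiable_imp_continuous_within)
    then have "isCont (\<lambda>v. \<phi> (norm v)) v"
      by (rule isCont_o2[rotated]) (intro continuous_intros)
    then show ?thesis
      by (intro continuous_intros)
  qed
qed

text \<open>With \<open>f r = \<phi> r * r\<close> increasing, \<open>G \<phi> s\<close> is the area
  between the graph of \<open>f\<close> and the height \<open>f s\<close> over
  \<open>[0, s]\<close>. This region contains the rectangle with base \<open>[0, d]\<close> and
  height \<open>f s - f d\<close>.\<close>

lemma G_ge:
  assumes "0 < d" "d < s"
  shows "G \<phi> s \<ge> d * (\<phi> s * s - \<phi> d * d)"
proof -
  let ?f = "\<lambda>r. \<phi> r * r"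
  have int: "?f integrable_on {x..y}" if "0 \<le> x" for x y
    using that flux_continuous by (intro integrable_continuous_interval) (auto intro: continuous_on_subset)
  have le: "?f x \<le> ?f y" if "0 \<le> x" "x \<le> y" "0 < y" for x y
    using that flux_less[of x y] phi_pos[of y] by (cases "x = 0"; cases "x = y") auto
  have "integral {0..s} ?f = integral {0..d} ?f + integral {d..s} ?f"
    using assms int by (intro Henstock_Kurzweil_Integration.integral_combine[symmetric]) auto
  also have "\<dots> \<le> integral {0..d} (\<lambda>_. ?f d) + integral {d..s} (\<lambda>_. ?f s)"
    using assms int le by (intro add_mono integral_le) auto
  also have "\<dots> = d * ?f d + (s - d) * ?f s"
    using assms by simp
  finally have "\<Phi> \<phi> s \<le> d * ?f d + (s - d) * ?f s"
    using assms by (simp add: \<Phi>_def)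
  moreover have "G \<phi> s = s * ?f s - \<Phi> \<phi> s"
    using assms by (simp add: G_def power2_eq_square)
  \<comment> \<open>The arithmetic is isolated with plain variables in place of the flux values and
    \<open>\<Phi> \<phi> s\<close>.\<close>
  moreover have "g \<ge> d * (y - z)" if "P \<le> d * z + (s - d) * y" "g = s * y - P" for g y z P :: real
    using that by (simp add: algebra_simps)
  ultimately show ?thesis
    by blast
qed

text \<open>A vector of norm at least \<open>e\<close> has \<open>G\<close> above a positive
  constant depending only on \<open>e\<close>, so small values of \<open>G\<close> force small
  vectors.\<close>

lemma tendsto_0_if_G_tendsto_0:
  fixes v :: "'b \<Rightarrow> 'a::real_normed_vector"
  assumes "((\<lambda>t. G \<phi> (norm (v t))) \<longlongrightarrow> 0) F"
  shows "(v \<longlongrightarrow> 0) F"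
proof (rule tendstoI)
  fix e :: real assume e: "e > 0"
  \<comment> \<open>Any \<open>d\<close> strictly between \<open>0\<close> and \<open>e\<close>
    would do; strictness makes the lower bound of \<open>G_ge\<close> positive.\<close>
  define d where "d = e / 2"
  have d: "0 < d" "d < e" using e by (auto simp: d_def)
  have "d * (\<phi> e * e - \<phi> d * d) > 0"
    using flux_less d by simp
  with assms have "\<forall>\<^sub>F t in F. G \<phi> (norm (v t)) < d * (\<phi> e * e - \<phi> d * d)"
    by (rule order_tendstoD)
  then show "\<forall>\<^sub>F t in F. dist (v t) 0 < e"
  proof (rule eventually_mono)
    fix t assume *: "G \<phi> (norm (v t)) < d * (\<phi> e * e - \<phi> d * d)"
    show "dist (v t) 0 < e"
    proof (rule ccontr)
      assume "\<not> dist (v t) 0 < e"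
      then have n: "norm (v t) \<ge> e" by simp
      then have "\<phi> e * e \<le> \<phi> (norm (v t)) * norm (v t)"
        using flux_less[OF e, of "norm (v t)"] by (cases "norm (v t) = e") auto
      then have "d * (\<phi> e * e - \<phi> d * d) \<le> d * (\<phi> (norm (v t)) * norm (v t) - \<phi> d * d)"
        using d by simp
      also have "\<dots> \<le> G \<phi> (norm (v t))"
        using d n by (intro G_ge) auto
      finally show False using * leD by blast
    qed
  qed
qed

end

text \<open>The path itself need not converge. Comparison with a nearest point \<open>z\<close> of
  \<open>K\<close> works since \<open>V z \<le> c < V (p t)\<close>, and boundedness makes
  \<open>V\<close> uniformly continuous where it matters.\<close>

lemma tendsto_comp_of_infdist_tendsto_0:
  fixes V :: "'a::euclidean_space \<Rightarrow> real" and p :: "real \<Rightarrow> 'a"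
  assumes V: "continuous_on UNIV V" and K: "closed K" "K \<noteq> {}" "\<And>z. z \<in> K \<Longrightarrow> V z \<le> c"
    and p: "\<forall>\<^sub>F t in F. V (p t) > c" "\<forall>\<^sub>F t in F. norm (p t) \<le> B"
    and lim: "((\<lambda>t. infdist (p t) K) \<longlongrightarrow> 0) F"
  shows "((\<lambda>t. V (p t)) \<longlongrightarrow> c) F"
proof (rule tendstoI)
  fix e :: real assume e: "e > 0"
  \<comment> \<open>The extra \<open>1\<close> in the radius leaves room for nearest points at
    distance less than \<open>1\<close> from the path.\<close>
  have "uniformly_continuous_on (cball 0 (B + 1)) V"
    using V by (intro compact_uniformly_continuous) (auto intro: continuous_on_subset)
  then obtain d where d: "d > 0"
    "\<And>x y. x \<in> cball 0 (B + 1) \<Longrightarrow> y \<in> cball 0 (B + 1) \<Longrightarrow> dist y x < d \<Longrightarrow> dist (V y) (V x) < e"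
    using e unfolding uniformly_continuous_on_def by meson
  have "\<forall>\<^sub>F t in F. infdist (p t) K < min d 1"
    using d lim by (intro order_tendstoD(2)) auto
  with p show "\<forall>\<^sub>F t in F. dist (V (p t)) c < e"
  proof eventually_elim
    case (elim t)
    obtain z where z: "z \<in> K" "infdist (p t) K = dist (p t) z"
      using infdist_attains_inf[OF K(1,2)] by blast
    then have dz: "dist (p t) z < d" "dist (p t) z < 1"
      using elim by auto
    then have "norm z \<le> B + 1"
      using elim norm_triangle_ineq4[of "p t" "p t - z"] by (simp add: dist_norm)
    then have "dist (V (p t)) (V z) < e"
      using elim dz by (intro d) auto
    then show ?case
      using K(3)[OF z(1)] elim by (simp add: dist_real_def)
  qed
qed

text \<open>The version within a set is what one-sided derivatives at the contact time require:
  reflection exchanges the two half-lines.\<close>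

lemma has_vector_derivative_reflect_within:
  fixes f :: "real \<Rightarrow> 'a::real_normed_vector"
  assumes "(f has_vector_derivative d) (at (b - t) within (-) b ` S)"
  shows "((\<lambda>s. f (b - s)) has_vector_derivative - d) (at t within S)"
proof -
  have "((-) b has_vector_derivative -1) (at t within S)"
    by (auto intro!: derivative_eq_intros)
  from vector_diff_chain_within[OF this assms] show ?thesis
    by (simp add: o_def)
qed

lemma has_vector_derivative_reflect:
  fixes f :: "real \<Rightarrow> 'a::real_normed_vector"
  assumes "(f has_vector_derivative d) (at (b - t))"
  shows "((\<lambda>s. f (b - s)) has_vector_derivative - d) (at t)"
  by (rule has_vector_derivative_reflect_within[OF has_vector_derivative_at_within[OF assms]])

subsection \<open>Doubling an orbit by reflection\<close>

text \<open>An orbit on \<open>[a, \<infinity>)\<close> leaving \<open>A\<close> at time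
  \<open>a\<close> and approaching \<open>B\<close> at infinity. The roles of \<open>A\<close> and
  \<open>B\<close> are left open so that the time-reversed connection fits as well;
  \<open>p'\<close> and \<open>p''\<close> are explicit so that reflected formulas can be
  substituted.\<close>

locale brake_orbit = phi_operator \<phi> l
  for \<phi> :: "real \<Rightarrow> real" and l :: real +
  fixes V :: "'a::euclidean_space \<Rightarrow> real" and c a :: real and A B :: "'a set"
    and p p' p'' :: "real \<Rightarrow> 'a"
  assumes V_continuous: "continuous_on UNIV V"
    and grad_continuous: "continuous_on UNIV (grad V)"
    and sublevel: "{x. V x \<le> c} = A \<union> B" "A \<noteq> {}" "B \<noteq> {}" "setdist A B > 0"
    and p_deriv: "\<And>t. t \<ge> a \<Longrightarrow> (p has_vector_derivative p' t) (at t within {a..})"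
    and p'_continuous: "continuous_on {a..} p'"
    and p'_deriv: "\<And>t. t > a \<Longrightarrow> (p' has_vector_derivative p'' t) (at t)"
    and p''_continuous: "continuous_on {a<..} p''"
    and flux_deriv: "\<And>t. t > a \<Longrightarrow>
      ((\<lambda>s. \<phi> (norm (p' s)) *\<^sub>R p' s) has_vector_derivative grad V (p t)) (at t)"
    and V_greater: "\<And>t. t > a \<Longrightarrow> V (p t) > c"
    and p_energy: "\<And>t. t > a \<Longrightarrow> G \<phi> (norm (p' t)) = V (p t) - c"
    and p_bounded: "bounded (p ` {a<..})"
    and p_start: "((\<lambda>t. infdist (p t) A) \<longlongrightarrow> 0) (at_right a)"
    and p_end: "((\<lambda>t. infdist (p t) B) \<longlongrightarrow> 0) at_top"
begin

section \<open>The contact point, rest at contact, and decay of the velocity at infinity\<close>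

lemma sublevel_closed: "closed (A \<union> B)"
  using V_continuous unfolding sublevel(1)[symmetric]
  by (intro closed_Collect_le) auto

text \<open>A limit point of \<open>A\<close> lies in the closed union, and the positive distance
  keeps it out of \<open>B\<close>.\<close>

lemma A_closed: "closed A"
proof -
  have "x \<notin> B" if "x \<in> closure A" for x
    using that sublevel(4) setdist_le_dist[of x "closure A" x B] by auto
  moreover have "closure A \<subseteq> A \<union> B"
    using sublevel_closed by (intro closure_minimal) auto
  ultimately have "closure A \<subseteq> A" by blast
  then show ?thesis by (simp add: closure_subset_eq)
qed

lemma B_closed: "closed B"
proof -
  have "x \<notin> A" if "x \<in> closure B" for x
    using that sublevel(4) setdist_le_dist[of x A x "closure B"] by auto
  moreover have "closure B \<subseteq> A \<union> B"
    using sublevel_closed by (intro closure_minimal) auto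
  ultimately have "closure B \<subseteq> B" by blast
  then show ?thesis by (simp add: closure_subset_eq)
qed

lemma p_tendsto_start: "(p \<longlongrightarrow> p a) (at_right a)"
  using has_vector_derivative_continuous[OF p_deriv[of a]]
  by (auto simp: continuous_within intro: tendsto_within_subset)

lemma p_start_in: "p a \<in> A"
proof -
  have "((\<lambda>t. infdist (p t) A) \<longlongrightarrow> infdist (p a) A) (at_right a)"
    using p_tendsto_start by (rule tendsto_infdist)
  then have "infdist (p a) A = 0"
    using p_start by (intro tendsto_unique) auto
  \<comment> \<open>Nonemptiness of \<open>A\<close> matters here: \<open>infdist\<close> to the
    empty set is \<open>0\<close> by convention.\<close>
  then show ?thesis
    using A_closed sublevel(2) by (simp add: in_closed_iff_infdist_zero)
qed

lemma V_tendsto_start: "((\<lambda>t. V (p t)) \<longlongrightarrow> V (p a)) (at_right a)"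
  using continuous_on_tendsto_compose[OF V_continuous p_tendsto_start] by simp

lemma V_start: "V (p a) = c"
proof (rule antisym)
  show "V (p a) \<le> c"
    using p_start_in sublevel(1) by auto
  show "c \<le> V (p a)"
    using V_greater by (intro tendsto_lowerbound[OF V_tendsto_start])
      (auto simp: eventually_at_filter intro: less_imp_le always_eventually)
qed

text \<open>The filter is arbitrary in order to treat the contact time and infinity alike.\<close>

lemma p'_tendsto_0:
  assumes "((\<lambda>t. V (p t)) \<longlongrightarrow> c) F" and "\<forall>\<^sub>F t in F. t > a"
  shows "(p' \<longlongrightarrow> 0) F"
proof (rule tendsto_0_if_G_tendsto_0)
  have "((\<lambda>t. V (p t) - c) \<longlongrightarrow> 0) F"
    using assms(1) by (simp add: LIM_zero)
  then show "((\<lambda>t. G \<phi> (norm (p' t))) \<longlongrightarrow> 0) F"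
    using assms(2) p_energy by (elim Lim_transform_eventually) (auto elim: eventually_mono)
qed

text \<open>The energy identity is given only for \<open>t > a\<close>, so the value at
  \<open>a\<close> is reached as a limit from the right.\<close>

lemma p'_start: "p' a = 0"
proof -
  have "(p' \<longlongrightarrow> 0) (at_right a)"
    using V_tendsto_start V_start by (intro p'_tendsto_0) (auto simp: eventually_at_filter)
  moreover have "(p' \<longlongrightarrow> p' a) (at_right a)"
    using p'_continuous by (auto simp: continuous_on_def intro: tendsto_within_subset)
  ultimately show ?thesis
    by (intro tendsto_unique) auto
qed

lemma p'_end: "(p' \<longlongrightarrow> 0) at_top"
proof (rule p'_tendsto_0)
  show a: "\<forall>\<^sub>F t in at_top. t > a"
    by (rule eventually_gt_at_top)
  obtain D where "\<And>t. t > a \<Longrightarrow> norm (p t) \<le> D"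
    using p_bounded unfolding bounded_iff by auto
  then have "\<forall>\<^sub>F t in at_top. norm (p t) \<le> D"
    using a by (rule eventually_mono[rotated])
  moreover have "\<forall>\<^sub>F t in at_top. V (p t) > c"
    using a V_greater by (rule eventually_mono)
  moreover have "V z \<le> c" if "z \<in> B" for z
    using that sublevel(1) by blast
  ultimately show "((\<lambda>t. V (p t)) \<longlongrightarrow> c) at_top"
    using tendsto_comp_of_infdist_tendsto_0[OF V_continuous B_closed sublevel(3) _ _ _ p_end] by blast
qed

section \<open>The doubled path and its regularity\<close>

definition double :: "real \<Rightarrow> 'a" where "double = (\<lambda>t. if t < a then p (2 * a - t) else p t)"
definition double' :: "real \<Rightarrow> 'a" where "double' t = (if t < a then - p' (2 * a - t) else p' t)"
text \<open>The signs from the two differentiations of the reflection cancel. It serves as second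
  derivative only away from \<open>a\<close>.\<close>

definition double'' :: "real \<Rightarrow> 'a" where "double'' t = (if t < a then p'' (2 * a - t) else p'' t)"

text \<open>One-sided derivatives on the two closed half-lines are glued; they match at
  \<open>a\<close> because the velocity is zero there.\<close>

lemma double_deriv: "(double has_vector_derivative double' t) (at t)"
proof -
  have reflected: "((\<lambda>t. p (2 * a - t)) has_vector_derivative - p' (2 * a - t)) (at t within {..a})"
    if "t \<le> a" for t
    using p_deriv[of "2 * a - t"] that by (intro has_vector_derivative_reflect_within) simp
  \<comment> \<open>The gluing rule adjoins to each piece the common part of the closures, which
    here is just \<open>a\<close>.\<close>
  have sets: "{..<a} \<union> closure {..<a} \<inter> closure {a..} = {..a}"
      "{a..} \<union> closure {..<a} \<inter> closure {a..} = {a..}"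
    by auto
  have "((\<lambda>t. if t \<in> {..<a} then p (2 * a - t) else p t) has_vector_derivative
      (if t \<in> {..<a} then - p' (2 * a - t) else p' t)) (at t within UNIV)"
  proof (rule has_vector_derivative_If_within_closures[where T = "{a..}"], unfold sets)
    assume "t \<in> closure {..<a}" "t \<in> closure {a..}"
    then have "t = a" by simp
    then show "p (2 * a - t) = p t" "- p' (2 * a - t) = p' t"
      by (simp_all add: p'_start)
  qed (use p_deriv reflected in auto)
  then show ?thesis
    by (simp add: double_def double'_def)
qed

lemma double'_continuous: "continuous_on UNIV double'"
proof -
  have "continuous_on {..a} (\<lambda>t. - p' (2 * a - t))"
    by (intro continuous_intros continuous_on_compose2[OF p'_continuous]) auto
  \<comment> \<open>At \<open>a\<close> the reflected formula gives \<open>- p' a\<close> and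
    \<open>double'\<close> gives \<open>p' a\<close>; both are \<open>0\<close>.\<close>
  then have "continuous_on {..a} double'"
    by (rule continuous_on_eq) (use p'_start in \<open>auto simp: double'_def\<close>)
  moreover have "continuous_on {a..} double'"
    using p'_continuous by (rule continuous_on_eq) (auto simp: double'_def)
  ultimately have "continuous_on ({..a} \<union> {a..}) double'"
    by (intro continuous_on_closed_Un) auto
  moreover have "{..a} \<union> {a..} = UNIV" by auto
  ultimately show ?thesis by simp
qed

lemma double'_deriv:
  assumes "t \<noteq> a"
  shows "(double' has_vector_derivative double'' t) (at t)"
proof (cases "t < a")
  case True
  have "((\<lambda>s. - p' (2 * a - s)) has_vector_derivative - (- p'' (2 * a - t))) (at t)"
    using True by (intro has_vector_derivative_minus has_vector_derivative_reflect p'_deriv) auto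
  then show ?thesis
    using True by (auto simp: double'_def double''_def intro: has_vector_derivative_transform_within_open[of _ _ _ "{..<a}"])
next
  case False
  then show ?thesis
    using assms p'_deriv[of t]
    by (auto simp: double'_def double''_def intro: has_vector_derivative_transform_within_open[of _ _ _ "{a<..}"])
qed

lemma double''_continuous: "continuous_on (UNIV - {a}) double''"
proof -
  have "continuous_on {..<a} (\<lambda>t. p'' (2 * a - t))"
    by (intro continuous_intros continuous_on_compose2[OF p''_continuous]) auto
  then have "continuous_on {..<a} double''"
    by (rule continuous_on_eq) (auto simp: double''_def)
  moreover have "continuous_on {a<..} double''"
    using p''_continuous by (rule continuous_on_eq) (auto simp: double''_def)
  ultimately have "continuous_on ({..<a} \<union> {a<..}) double''"
    by (intro continuous_on_open_Un) auto
  moreover have "{..<a} \<union> {a<..} = UNIV - {a}" by auto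
  ultimately show ?thesis by simp
qed

lemma double_continuous: "continuous_on UNIV double"
  using double_deriv by (meson continuous_at_imp_continuous_on has_vector_derivative_continuous)

lemma vector_derivative_double: "vector_derivative double (at t) = double' t"
  using double_deriv by (rule vector_derivative_at)

text \<open>The flux is odd in the velocity, so the sign from reversing the velocity cancels the
  sign from differentiating the reflection.\<close>

lemma double_flux_deriv:
  assumes "t \<noteq> a"
  shows "((\<lambda>s. \<phi> (norm (double' s)) *\<^sub>R double' s) has_vector_derivative grad V (double t)) (at t)"
proof (cases "t < a")
  case True
  have "((\<lambda>s. - (\<phi> (norm (p' (2 * a - s))) *\<^sub>R p' (2 * a - s))) has_vector_derivative
      - (- grad V (p (2 * a - t)))) (at t)"
    using True by (intro has_vector_derivative_minus
        has_vector_derivative_reflect[of "\<lambda>s. \<phi> (norm (p' s)) *\<^sub>R p' s"] flux_deriv) auto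
  from has_vector_derivative_transform_within_open[OF this, of "{..<a}" "\<lambda>s. \<phi> (norm (double' s)) *\<^sub>R double' s"]
  show ?thesis
    using True by (simp add: double_def double'_def)
next
  case False
  with assms have "t > a" by simp
  from has_vector_derivative_transform_within_open[OF flux_deriv[OF this], of "{a<..}" "\<lambda>s. \<phi> (norm (double' s)) *\<^sub>R double' s"]
  show ?thesis
    using \<open>t > a\<close> by (simp add: double_def double'_def)
qed

lemma double_C1: "Ck_on 1 UNIV double"
  using Ck_on_SucI_open[OF open_UNIV double_deriv, of 0] double'_continuous by simp

lemma double_C2:
  assumes "open S" and "a \<notin> S"
  shows "Ck_on 2 S double"
proof -
  have "Ck_on 0 S double''"
    using double''_continuous assms by (auto intro: continuous_on_subset)
  then have "Ck_on (Suc 0) S double'"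
    using assms(2) by (intro Ck_on_SucI_open[OF assms(1) double'_deriv]) auto
  then show ?thesis
    unfolding numeral_2_eq_2 by (rule Ck_on_SucI_open[OF assms(1) double_deriv])
qed

section \<open>The equation for the doubled path: classical off \<open>a\<close>, weak on the whole
  line\<close>

lemma double_classical:
  assumes "open S" and "a \<notin> S"
  shows "classical_solution \<phi> V S double"
  unfolding classical_solution_def vector_derivative_double
proof (intro conjI ballI)
  show "Ck_on 2 S double" using assms by (rule double_C2)
  show "((\<lambda>s. \<phi> (norm (double' s)) *\<^sub>R double' s) has_vector_derivative grad V (double t)) (at t)" if "t \<in> S" for t
    using that assms(2) by (intro double_flux_deriv) auto
qed

text \<open>The derivative of the compactly supported product
  \<open>\<psi> t *\<^sub>R double t\<close> integrates to zero.\<close>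

lemma double_weak_derivative: "has_weak_derivative UNIV double double'"
  unfolding has_weak_derivative_def
proof (intro conjI allI impI)
  show "double \<in> L1_loc UNIV" "double' \<in> L1_loc UNIV"
    using double_continuous double'_continuous by (auto intro: continuous_L1_loc)
  fix \<psi> :: "real \<Rightarrow> real"
  assume "test_function (interior UNIV) \<psi>"
  then have \<psi>_test: "test_function UNIV \<psi>" by simp
  define \<psi>' where "\<psi>' t = vector_derivative \<psi> (at t)" for t
  have \<psi>: "(\<psi> has_vector_derivative \<psi>' t) (at t)" "continuous_on UNIV \<psi>" "continuous_on UNIV \<psi>'" for t
    using test_function_UNIV(1-3)[OF \<psi>_test] unfolding \<psi>'_def .
  obtain M where M: "\<And>t. \<bar>t\<bar> \<ge> M \<Longrightarrow> \<psi> t = 0" "\<And>t. \<bar>t\<bar> \<ge> M \<Longrightarrow> \<psi>' t = 0"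
    using test_function_UNIV(4)[OF \<psi>_test] unfolding \<psi>'_def by blast
  have "integral\<^sup>L lebesgue (\<lambda>t. \<psi> t *\<^sub>R double' t + \<psi>' t *\<^sub>R double t) = 0"
    using \<psi> M double_continuous double'_continuous double_deriv
    by (intro integral_derivative_compact_support[where F = "\<lambda>t. \<psi> t *\<^sub>R double t" and S = "{}" and M = M]
        continuous_intros has_vector_derivative_scaleR)
      (auto simp: has_real_derivative_iff_has_vector_derivative)
  moreover have "integrable lebesgue (\<lambda>t. \<psi> t *\<^sub>R double' t)" "integrable lebesgue (\<lambda>t. \<psi>' t *\<^sub>R double t)"
    using \<psi> M double_continuous double'_continuous
    by (auto intro!: integrable_continuous_compact_support(1)[where M = M] continuous_intros)
  ultimately show "(LINT t:UNIV|lebesgue. vector_derivative \<psi> (at t) *\<^sub>R double t)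
      = - (LINT t:UNIV|lebesgue. \<psi> t *\<^sub>R double' t)"
    by (simp add: \<psi>'_def set_lebesgue_integral_def eq_neg_iff_add_eq_0 add.commute)
qed

text \<open>Off \<open>a\<close> the integrand is the derivative of flux times test function. This
  product is continuous at \<open>a\<close>, so no jump term arises.\<close>

lemma double_weak: "weak_solution \<phi> V UNIV double"
  unfolding weak_solution_def
proof (intro exI[of _ double'] conjI double_weak_derivative allI impI)
  fix \<psi> :: "real \<Rightarrow> 'a"
  assume \<psi>_test: "test_function UNIV \<psi>"
  define \<psi>' where "\<psi>' t = vector_derivative \<psi> (at t)" for t
  have \<psi>: "(\<psi> has_vector_derivative \<psi>' t) (at t)" "continuous_on UNIV \<psi>" "continuous_on UNIV \<psi>'" for t
    using test_function_UNIV(1-3)[OF \<psi>_test] unfolding \<psi>'_def .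
  obtain M where M: "\<And>t. \<bar>t\<bar> \<ge> M \<Longrightarrow> \<psi> t = 0" "\<And>t. \<bar>t\<bar> \<ge> M \<Longrightarrow> \<psi>' t = 0"
    using test_function_UNIV(4)[OF \<psi>_test] unfolding \<psi>'_def by blast
  define P where "P t = \<phi> (norm (double' t)) *\<^sub>R double' t" for t
  let ?f = "\<lambda>t. P t \<bullet> \<psi>' t + grad V (double t) \<bullet> \<psi> t"
  have P: "continuous_on UNIV P"
    unfolding P_def by (rule continuous_on_compose2[OF flux_vector_continuous double'_continuous]) simp
  have gr: "continuous_on UNIV (\<lambda>t. grad V (double t))"
    by (rule continuous_on_compose2[OF grad_continuous double_continuous]) simp
  have f: "continuous_on UNIV ?f"
    using P gr \<psi>(2,3) by (intro continuous_intros)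
  have "((\<lambda>t. P t \<bullet> \<psi> t) has_vector_derivative ?f t) (at t)" if "t \<noteq> a" for t
    using bounded_bilinear.has_vector_derivative[OF bounded_bilinear_inner
        double_flux_deriv[OF that, folded P_def] \<psi>(1)] by simp
  then have "integral\<^sup>L lebesgue ?f = 0"
    using \<psi> M P f
    by (intro integral_derivative_compact_support[where F = "\<lambda>t. P t \<bullet> \<psi> t" and S = "{a}" and M = M])
      (auto intro!: continuous_intros)
  moreover have "integrable lebesgue ?f"
    using M f by (intro integrable_continuous_compact_support(1)[where M = M]) auto
  ultimately show "let f = \<lambda>t. (\<phi> (norm (double' t)) *\<^sub>R double' t) \<bullet> vector_derivative \<psi> (at t) + grad V (double t) \<bullet> \<psi> t
      in set_integrable lebesgue UNIV f \<and> (LINT t:UNIV|lebesgue. f t) = 0"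
    by (simp add: Let_def set_integrable_def set_lebesgue_integral_def \<psi>'_def P_def)
qed

section \<open>Symmetry, energy and limits of the doubled path\<close>

lemma double_reflect: "double (a - t) = double (a + t)"
  by (auto simp: double_def)

lemma double_V_greater: "t \<noteq> a \<Longrightarrow> V (double t) > c"
  by (simp add: double_def V_greater)

text \<open>Before \<open>a\<close> the norm absorbs the reversed sign; at \<open>a\<close> the
  kinetic term is \<open>G \<phi> 0 = 0\<close> and the potential equals \<open>c\<close>.\<close>

lemma double_energy: "energy \<phi> V double t = - c"
proof -
  consider "t < a" | "t = a" | "t > a" by linarith
  then show ?thesis
    unfolding energy_def vector_derivative_double
    by cases (auto simp: double_def double'_def p_energy V_start p'_start G_def[of _ 0])
qed

lemma filterlim_reflect: "filterlim (\<lambda>t. 2 * a - t) at_top at_bot"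
  unfolding filterlim_at_top
proof
  fix Z
  show "\<forall>\<^sub>F t in at_bot. Z \<le> 2 * a - t"
    using eventually_le_at_bot[of "2 * a - Z"] by (rule eventually_mono) simp
qed

lemma double'_tendsto_0: "(double' \<longlongrightarrow> 0) at_top" "(double' \<longlongrightarrow> 0) at_bot"
proof -
  show "(double' \<longlongrightarrow> 0) at_top"
    using p'_end by (rule Lim_transform_eventually)
      (auto simp: double'_def intro: eventually_mono[OF eventually_gt_at_top[of a]])
  have "((\<lambda>t. - p' (2 * a - t)) \<longlongrightarrow> - 0) at_bot"
    by (intro tendsto_minus filterlim_compose[OF p'_end filterlim_reflect])
  then have "((\<lambda>t. - p' (2 * a - t)) \<longlongrightarrow> 0) at_bot" by simp
  then show "(double' \<longlongrightarrow> 0) at_bot"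
    by (rule Lim_transform_eventually)
      (auto simp: double'_def intro: eventually_mono[OF eventually_gt_at_bot[of a]])
qed

lemma double_infdist_tendsto_0:
  "((\<lambda>t. infdist (double t) B) \<longlongrightarrow> 0) at_top" "((\<lambda>t. infdist (double t) B) \<longlongrightarrow> 0) at_bot"
proof -
  show "((\<lambda>t. infdist (double t) B) \<longlongrightarrow> 0) at_top"
    using p_end by (rule Lim_transform_eventually)
      (auto simp: double_def intro: eventually_mono[OF eventually_gt_at_top[of a]])
  show "((\<lambda>t. infdist (double t) B) \<longlongrightarrow> 0) at_bot"
    using filterlim_compose[OF p_end filterlim_reflect] by (rule Lim_transform_eventually)
      (auto simp: double_def intro: eventually_mono[OF eventually_gt_at_bot[of a]])
qed

text \<open>Collected in the shape of the final conclusion, so that both cases become instances of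
  it.\<close>

lemma double_solution:
  "Ck_on 1 UNIV double \<and> Ck_on 2 (UNIV - {a}) double \<and>
   weak_solution \<phi> V UNIV double \<and>
   classical_solution \<phi> V {..<a} double \<and> classical_solution \<phi> V {a<..} double \<and>
   (\<forall>t. energy \<phi> V double t = - c) \<and>
   vector_derivative double (at a) = 0 \<and>
   double a \<in> A \<and>
   (\<forall>t. t \<noteq> a \<longrightarrow> V (double t) > c) \<and>
   (\<forall>t. double (a - t) = double (a + t)) \<and>
   ((\<lambda>t. vector_derivative double (at t)) \<longlongrightarrow> 0) at_bot \<and>
   ((\<lambda>t. vector_derivative double (at t)) \<longlongrightarrow> 0) at_top \<and>
   ((\<lambda>t. infdist (double t) B) \<longlongrightarrow> 0) at_bot \<and>
   ((\<lambda>t. infdist (double t) B) \<longlongrightarrow> 0) at_top"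
  unfolding vector_derivative_double
  using double_C1 double_C2[of "UNIV - {a}"] double_weak double_classical[of "{..<a}"]
    double_classical[of "{a<..}"] double_energy p'_start p_start_in double_V_greater double_reflect double'_tendsto_0 double_infdist_tendsto_0
  by (auto simp: double'_def[of a] double_def[THEN fun_cong, of a])

end

text \<open>Replaces the derivatives within \<open>closure I\<close>, within \<open>I\<close> and at
  a point by one function \<open>q'\<close>. Working with a general \<open>I\<close> serves both
  half-lines.\<close>

lemma c_connection_E:
  fixes q :: "real \<Rightarrow> 'a::euclidean_space"
  assumes conn: "c_connection \<phi> V c A B \<alpha> \<omega> q" and I: "einterval \<alpha> \<omega> = I"
  obtains q' q'' where
    "\<And>t. t \<in> closure I \<Longrightarrow> (q has_vector_derivative q' t) (at t within closure I)"
    "continuous_on (closure I) q'"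
    "\<And>t. t \<in> I \<Longrightarrow> (q' has_vector_derivative q'' t) (at t)"
    "continuous_on I q''"
    "\<And>t. t \<in> I \<Longrightarrow>
      ((\<lambda>s. \<phi> (norm (q' s)) *\<^sub>R q' s) has_vector_derivative grad V (q t)) (at t)"
    "\<And>t. t \<in> I \<Longrightarrow> V (q t) > c"
    "\<And>t. t \<in> I \<Longrightarrow> G \<phi> (norm (q' t)) = V (q t) - c"
    "bounded (q ` I)"
    "((\<lambda>t. infdist (q (real_of_ereal t)) A) \<longlongrightarrow> 0) (at_right \<alpha>)"
    "((\<lambda>t. infdist (q (real_of_ereal t)) B) \<longlongrightarrow> 0) (at_left \<omega>)"
proof -
  \<comment> \<open>Taken within the closure, so that it includes the one-sided velocity at a finite
    contact time.\<close>
  define q' where "q' t = vector_derivative q (at t within closure I)" for t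
  define q'' where "q'' t = vector_derivative q' (at t)" for t
  have op: "open I" using I by auto
  note conn' = conn[unfolded c_connection_def Let_def I classical_solution_def]
  have C1: "Ck_on (Suc 0) (closure I) q" and C2: "Ck_on (Suc (Suc 0)) I q"
    using conn' by (auto simp del: Ck_on.simps simp: numeral_2_eq_2)
  have d: "(q has_vector_derivative q' t) (at t within closure I)" if "t \<in> closure I" for t
    using C1 that by (auto simp: q'_def vector_derivative_works)
  have within: "at t within I = at t" "at t within closure I = at t" if "t \<in> I" for t
    using that op interior_maximal[OF closure_subset op]
    by (auto intro: at_within_open at_within_interior)
  have q': "vector_derivative q (at t within I) = q' t" "vector_derivative q (at t) = q' t" if "t \<in> I" for t
    using within[OF that] by (simp_all add: q'_def)
  have "Ck_on (Suc 0) I q'"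
    using C2 q'(1) by (intro Ck_on_cong[of I q' "\<lambda>t. vector_derivative q (at t within I)"]) auto
  then have d2: "(q' has_vector_derivative q'' t) (at t)" if "t \<in> I" for t
    using within(1) that by (auto simp: q''_def vector_derivative_works)
  have c2: "continuous_on I q''"
    using \<open>Ck_on (Suc 0) I q'\<close> within(1) by (auto simp: q''_def cong: continuous_on_cong)
  have fl: "((\<lambda>s. \<phi> (norm (q' s)) *\<^sub>R q' s) has_vector_derivative grad V (q t)) (at t)" if "t \<in> I" for t
  proof -
    have "((\<lambda>s. \<phi> (norm (vector_derivative q (at s))) *\<^sub>R vector_derivative q (at s))
        has_vector_derivative grad V (q t)) (at t)"
      using conn' that by blast
    then show ?thesis
      by (rule has_vector_derivative_transform_within_open[OF _ op that]) (simp add: q'(2))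
  qed
  have "continuous_on (closure I) q"
    using d by (auto simp: continuous_on_eq_continuous_within intro: has_vector_derivative_continuous)
  then have b: "bounded (q ` I)"
    using conn' closure_subset by (intro continuous_Linf_bounded[OF op]) (auto intro: continuous_on_subset)
  have en: "G \<phi> (norm (q' t)) = V (q t) - c" if "t \<in> I" for t
  proof -
    have "energy \<phi> V q t = - c" using conn' that by blast
    then show ?thesis using q'(2)[OF that] by (simp add: energy_def)
  qed
  show ?thesis
    by (rule that[of q' q'', OF d _ d2 c2 fl _ en b]) (use conn' C1 in \<open>auto simp: q'_def\<close>)
qed

theorem proposition3p17:
  fixes \<phi> :: "real \<Rightarrow> real" and l m c :: real
    and V :: "real ^ 'n \<Rightarrow> real" and Vm Vp :: "(real ^ 'n) set"
    and q :: "real \<Rightarrow> real ^ 'n" and \<alpha> \<omega> :: ereal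
  assumes "Ck_on 1 {0<..} \<phi>" and "\<forall>s>0. \<phi> s > 0"
    and "1 < l" and "l \<le> m"
    and "\<forall>s>0. deriv (\<lambda>r. \<phi> r * r) s > 0"
    and "\<forall>s>0. l - 1 \<le> deriv (\<lambda>r. \<phi> r * r) s / \<phi> s \<and> deriv (\<lambda>r. \<phi> r * r) s / \<phi> s \<le> m - 1"
    and "\<forall>x. V differentiable (at x)" and "continuous_on UNIV (grad V)"
    and "{x. V x \<le> c} = Vm \<union> Vp" and "Vm \<noteq> {}" and "Vp \<noteq> {}" and "setdist Vm Vp > 0"
    and "\<exists>R>0. (INF p\<in>\<Gamma> \<phi> V c Vm Vp. J \<phi> V c p) =
           (INF p\<in>{p \<in> \<Gamma> \<phi> V c Vm Vp. Linf_norm UNIV p \<le> ennreal R}. J \<phi> V c p)"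
    and "c_connection \<phi> V c Vm Vp \<alpha> \<omega> q"
  shows
    "(\<forall>a. \<alpha> = ereal a \<and> \<omega> = \<infinity> \<longrightarrow>
       (let qc = (\<lambda>t. if t < a then q (2 * a - t) else q t) in
          Ck_on 1 UNIV qc \<and> Ck_on 2 (UNIV - {a}) qc \<and>
          weak_solution \<phi> V UNIV qc \<and>
          classical_solution \<phi> V {..<a} qc \<and> classical_solution \<phi> V {a<..} qc \<and>
          (\<forall>t. energy \<phi> V qc t = - c) \<and>
          vector_derivative qc (at a) = 0 \<and>
          qc a \<in> Vm \<and>
          (\<forall>t. t \<noteq> a \<longrightarrow> V (qc t) > c) \<and>
          (\<forall>t. qc (a - t) = qc (a + t)) \<and>
          ((\<lambda>t. vector_derivative qc (at t)) \<longlongrightarrow> 0) at_bot \<and>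
          ((\<lambda>t. vector_derivative qc (at t)) \<longlongrightarrow> 0) at_top \<and>
          ((\<lambda>t. infdist (qc t) Vp) \<longlongrightarrow> 0) at_bot \<and>
          ((\<lambda>t. infdist (qc t) Vp) \<longlongrightarrow> 0) at_top)) \<and>
     (\<forall>w. \<alpha> = - \<infinity> \<and> \<omega> = ereal w \<longrightarrow>
       (let qc = (\<lambda>t. if t \<le> w then q t else q (2 * w - t)) in
          Ck_on 1 UNIV qc \<and> Ck_on 2 (UNIV - {w}) qc \<and>
          weak_solution \<phi> V UNIV qc \<and>
          classical_solution \<phi> V {..<w} qc \<and> classical_solution \<phi> V {w<..} qc \<and>
          (\<forall>t. energy \<phi> V qc t = - c) \<and>
          vector_derivative qc (at w) = 0 \<and>
          qc w \<in> Vp \<and>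
          (\<forall>t. t \<noteq> w \<longrightarrow> V (qc t) > c) \<and>
          (\<forall>t. qc (w - t) = qc (w + t)) \<and>
          ((\<lambda>t. vector_derivative qc (at t)) \<longlongrightarrow> 0) at_bot \<and>
          ((\<lambda>t. vector_derivative qc (at t)) \<longlongrightarrow> 0) at_top \<and>
          ((\<lambda>t. infdist (qc t) Vm) \<longlongrightarrow> 0) at_bot \<and>
          ((\<lambda>t. infdist (qc t) Vm) \<longlongrightarrow> 0) at_top))"
proof -
  have pd: "\<phi> differentiable (at s)" if "s > 0" for s
  proof -
    have "\<phi> differentiable (at s within {0<..})"
      using assms(1) that by simp
    then show ?thesis
      using that at_within_open[of s "{0<..}"] by simp
  qed
  have ge: "(l - 1) * \<phi> s \<le> deriv (\<lambda>r. \<phi> r * r) s" if "s > 0" for s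
    using assms(2,6) that by (metis pos_le_divide_eq)
  interpret phi_operator \<phi> l
    using assms(2,3,5) pd ge by unfold_locales auto
  have V: "continuous_on UNIV V"
    using assms(7) by (simp add: continuous_at_imp_continuous_on differentiable_imp_continuous_within)
  let "(\<forall>a. _ a \<longrightarrow> ?A a) \<and> (\<forall>w. _ w \<longrightarrow> ?B w)" = ?thesis
  have "?A a" if ends: "\<alpha> = ereal a" "\<omega> = \<infinity>" for a
  proof -
    have "einterval \<alpha> \<omega> = {a<..}"
      using ends by simp
    from c_connection_E[OF assms(14) this] obtain q' q'' where q:
      "\<And>t. t \<in> closure {a<..} \<Longrightarrow> (q has_vector_derivative q' t) (at t within closure {a<..})"
      "continuous_on (closure {a<..}) q'"
      "\<And>t. t \<in> {a<..} \<Longrightarrow> (q' has_vector_derivative q'' t) (at t)"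
      "continuous_on {a<..} q''"
      "\<And>t. t \<in> {a<..} \<Longrightarrow>
        ((\<lambda>s. \<phi> (norm (q' s)) *\<^sub>R q' s) has_vector_derivative grad V (q t)) (at t)"
      "\<And>t. t \<in> {a<..} \<Longrightarrow> V (q t) > c"
      "\<And>t. t \<in> {a<..} \<Longrightarrow> G \<phi> (norm (q' t)) = V (q t) - c"
      "bounded (q ` {a<..})"
      "((\<lambda>t. infdist (q (real_of_ereal t)) Vm) \<longlongrightarrow> 0) (at_right \<alpha>)"
      "((\<lambda>t. infdist (q (real_of_ereal t)) Vp) \<longlongrightarrow> 0) (at_left \<omega>)"
      by blast
    interpret orbit: brake_orbit \<phi> l V c a Vm Vp q q' q''
    proof unfold_locales
      \<comment> \<open>The extended-real filters at the ends are images of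
        \<open>at_right a\<close> and \<open>at_top\<close> under \<open>ereal\<close>.\<close>
      show "((\<lambda>t. infdist (q t) Vm) \<longlongrightarrow> 0) (at_right a)" "((\<lambda>t. infdist (q t) Vp) \<longlongrightarrow> 0) at_top"
        using q(9,10) by (simp_all add: ends at_right_ereal at_left_PInf filterlim_filtermap)
    qed (use V assms q in \<open>simp_all\<close>)
    \<comment> \<open>\<open>double\<close> is defined by an equation between functions, so
      unfolding it yields the required path literally.\<close>
    show ?thesis
      using orbit.double_solution unfolding orbit.double_def Let_def .
  qed
  moreover have "?B w" if ends: "\<alpha> = - \<infinity>" "\<omega> = ereal w" for w
  proof -
    have "einterval \<alpha> \<omega> = {..<w}"
      using ends by simp
    from c_connection_E[OF assms(14) this] obtain q' q'' where q:
      "\<And>t. t \<in> closure {..<w} \<Longrightarrow> (q has_vector_derivative q' t) (at t within closure {..<w})"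
      "continuous_on (closure {..<w}) q'"
      "\<And>t. t \<in> {..<w} \<Longrightarrow> (q' has_vector_derivative q'' t) (at t)"
      "continuous_on {..<w} q''"
      "\<And>t. t \<in> {..<w} \<Longrightarrow>
        ((\<lambda>s. \<phi> (norm (q' s)) *\<^sub>R q' s) has_vector_derivative grad V (q t)) (at t)"
      "\<And>t. t \<in> {..<w} \<Longrightarrow> V (q t) > c"
      "\<And>t. t \<in> {..<w} \<Longrightarrow> G \<phi> (norm (q' t)) = V (q t) - c"
      "bounded (q ` {..<w})"
      "((\<lambda>t. infdist (q (real_of_ereal t)) Vm) \<longlongrightarrow> 0) (at_right \<alpha>)"
      "((\<lambda>t. infdist (q (real_of_ereal t)) Vp) \<longlongrightarrow> 0) (at_left \<omega>)"
      by blast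
    \<comment> \<open>The reversed path starts on \<open>Vp\<close> at time \<open>w\<close> and
      approaches \<open>Vm\<close>, so the two sets swap; velocity changes sign and acceleration
      does not.\<close>
    interpret orbit: brake_orbit \<phi> l V c w Vp Vm
      "\<lambda>t. q (2 * w - t)" "\<lambda>t. - q' (2 * w - t)" "\<lambda>t. q'' (2 * w - t)"
    proof unfold_locales
      have lim: "((\<lambda>t. infdist (q t) Vp) \<longlongrightarrow> 0) (at_left w)"
          "((\<lambda>t. infdist (q t) Vm) \<longlongrightarrow> 0) at_bot"
        using q(9,10) by (simp_all add: ends at_left_ereal at_right_MInf filterlim_filtermap)
      have "filterlim ((-) (2 * w)) (at_left w) (at_right w)"
        by (auto simp: filterlim_at eventually_at_filter intro!: tendsto_eq_intros)
      then show "((\<lambda>t. infdist (q (2 * w - t)) Vp) \<longlongrightarrow> 0) (at_right w)"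
        by (rule filterlim_compose[OF lim(1)])
      have "filterlim ((-) (2 * w)) at_bot at_top"
        unfolding filterlim_at_bot
      proof
        show "\<forall>\<^sub>F t in at_top. 2 * w - t \<le> Z" for Z
          using eventually_ge_at_top[of "2 * w - Z"] by (rule eventually_mono) simp
      qed
      then show "((\<lambda>t. infdist (q (2 * w - t)) Vm) \<longlongrightarrow> 0) at_top"
        by (rule filterlim_compose[OF lim(2)])
      show "((\<lambda>t. q (2 * w - t)) has_vector_derivative - q' (2 * w - t)) (at t within {w..})"
        if "w \<le> t" for t
        using q(1)[of "2 * w - t"] that by (intro has_vector_derivative_reflect_within) simp
      show "continuous_on {w..} (\<lambda>t. - q' (2 * w - t))"
        by (intro continuous_intros continuous_on_compose2[OF q(2)]) auto
      show "((\<lambda>t. - q' (2 * w - t)) has_vector_derivative q'' (2 * w - t)) (at t)" if "w < t" for t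
        using has_vector_derivative_minus[OF has_vector_derivative_reflect[OF q(3)[of "2 * w - t"]]] that
        by simp
      show "continuous_on {w<..} (\<lambda>t. q'' (2 * w - t))"
        by (intro continuous_intros continuous_on_compose2[OF q(4)]) auto
      show "((\<lambda>s. \<phi> (norm (- q' (2 * w - s))) *\<^sub>R - q' (2 * w - s)) has_vector_derivative
          grad V (q (2 * w - t))) (at t)" if "w < t" for t
        using has_vector_derivative_minus[OF has_vector_derivative_reflect[OF q(5)[of "2 * w - t"]]] that
        by simp
      have "(\<lambda>t. q (2 * w - t)) ` {w<..} \<subseteq> q ` {..<w}"
        by auto
      then show "bounded ((\<lambda>t. q (2 * w - t)) ` {w<..})"
        using q(8) bounded_subset by blast
    qed (use V assms q in \<open>simp_all add: Un_commute setdist_sym\<close>)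
    \<comment> \<open>Reflecting twice restores \<open>q\<close>. The strict and non-strict case
      splits agree at \<open>t = w\<close>, since \<open>2 * w - w = w\<close>.\<close>
    have reflection: "orbit.double = (\<lambda>t. if t \<le> w then q t else q (2 * w - t))"
      by (auto simp: orbit.double_def)
    show ?thesis
      using orbit.double_solution unfolding reflection Let_def .
  qed
  ultimately show ?thesis
    by blast
qed

end
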